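(* For nonnegative integers $i,r,n$ with $n\geq 1$, $r\geq 2$ and $0\leq i\leq r-1$, the polynomial $E_{r,n}^i(x)$ has only real zeros.
   Context: For integers $r\geq 2$ and $n\geq 0$, let $\mathcal{SW}'(n,r)$ be the set of words $w=(w_0,w_1,\ldots,w_n)\in\{0,1,\ldots,r-1\}^{n+1}$ such that $w_j\neq w_{j+1}$ for $j=0,1,\ldots,n-1$ and $w_0=0$ (no condition on $w_n$). An ascent of $w$ is an index $j\in\{0,\ldots,n-1\}$ with $w_j<w_{j+1}$, and $\operatorname{asc}(w)$ is the number of ascents of $w$. For $0\le i\le r-1$, $$E_{r,n}^i(x)=\sum_{w\in\mathcal{SW}'(n,r),\ w_n=i} x^{\operatorname{asc}(w)}.$$ *)

theory Defs
  imports "HOL-Computational_Algebra.Polynomial" Complex_Main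
begin

definition SW' :: "nat \<Rightarrow> nat \<Rightarrow> nat list set" where
  "SW' n r = {w. length w = n + 1 \<and> set w \<subseteq> {0..<r} \<and>
                 (\<forall>j<n. w ! j \<noteq> w ! (j + 1)) \<and> w ! 0 = 0}"

definition asc :: "nat list \<Rightarrow> nat" where
  "asc w = card {j. j + 1 < length w \<and> w ! j < w ! (j + 1)}"

definition E :: "nat \<Rightarrow> nat \<Rightarrow> nat \<Rightarrow> real poly" where
  "E r n i = (\<Sum>w\<in>{w \<in> SW' n r. w ! n = i}. monom 1 (asc w))"

(* The zero polynomial counts as having only real zeros. This convention is needed here:
   E r 1 0 = 0 for every r, and for r = 2 the polynomial E 2 n i vanishes whenever n + i
   is odd, since the words in SW' n 2 alternate. *)
definition only_real_zeros :: "real poly \<Rightarrow> bool" where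
  "only_real_zeros p \<longleftrightarrow>
     p = 0 \<or> (\<forall>z::complex. poly (map_poly complex_of_real p) z = 0 \<longrightarrow> z \<in> \<real>)"

end

theory Submission imports Defs begin

text \<open>Fix a point \<open>z\<close> of the upper half plane and extend the values at \<open>z\<close> of the polynomials of
  length \<open>n\<close> to a sequence \<open>u\<close> with \<open>u (k + r) = z * u k\<close>. Appending a letter to the words then
  replaces \<open>u\<close> by the sums over the windows \<open>i < k < i + r\<close>. The arguments of \<open>u\<close> increase
  along the sequence and turn by exactly the angle of \<open>z\<close>, less than a half turn, within one
  period; this is the pointwise form of the interlacing of the polynomials, and it is inherited by
  the window sums. The terms of a window therefore lie in a sector smaller than a half plane, so a
  window sum vanishes only if all its terms do. Hence which values vanish does not depend
  on \<open>z\<close>, and a polynomial with a zero in the upper half plane vanishes identically.\<close>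

section \<open>Oriented area of two plane vectors, and sequences that turn counterclockwise\<close>

definition cross :: "complex \<Rightarrow> complex \<Rightarrow> real" where
  "cross a b = Im (cnj a * b)"

lemma cross_add_left: "cross (a + b) c = cross a c + cross b c"
  and cross_add_right: "cross a (b + c) = cross a b + cross a c"
  by (simp_all add: cross_def algebra_simps)

lemma cross_self [simp]: "cross a a = 0"
  by (simp add: cross_def)

lemma cross_mult_self: "cross a (z * a) = (cmod a)\<^sup>2 * Im z"
  by (simp add: cross_def cmod_power2) (simp add: algebra_simps power2_eq_square)

lemma cross_sum_left: "cross (\<Sum>a\<in>A. f a) b = (\<Sum>a\<in>A. cross (f a) b)"
  and cross_sum_right: "cross b (\<Sum>a\<in>A. f a) = (\<Sum>a\<in>A. cross b (f a))"
  by (simp_all add: cross_def sum_distrib_left sum_distrib_right)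

text \<open>\<open>0 \<le> cross a b\<close> means that \<open>b\<close> is reached from
  \<open>a\<close> by a counterclockwise turn of at most a half turn, or that one of them is 0.
  Stating the order of arguments this way allows zero entries. Comparison stops after one period
  because a longer turn may exceed a half turn.\<close>

definition rotating :: "nat \<Rightarrow> complex \<Rightarrow> (nat \<Rightarrow> complex) \<Rightarrow> bool" where
  "rotating r z u \<longleftrightarrow> (\<forall>k. u (k + r) = z * u k) \<and>
     (\<forall>a b. a \<le> b \<longrightarrow> b \<le> a + r \<longrightarrow> 0 \<le> cross (u a) (u b))"

lemma rotating_shift: "rotating r z u \<Longrightarrow> u (k + r) = z * u k"
  by (simp add: rotating_def)

lemma rotating_cross: "rotating r z u \<Longrightarrow> a \<le> b \<Longrightarrow> b \<le> a + r \<Longrightarrow> 0 \<le> cross (u a) (u b)"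
  by (simp add: rotating_def)

lemma rotating_cross_shift:
  assumes "rotating r z u" "a \<le> b + r" "b \<le> a"
  shows "0 \<le> cross (u a) (z * u b)"
  using rotating_cross[OF assms(1), of a "b + r"] rotating_shift[OF assms(1), of b] assms by simp

section \<open>Window sums, their zeros and their iterates\<close>

definition window_sum :: "nat \<Rightarrow> (nat \<Rightarrow> complex) \<Rightarrow> nat \<Rightarrow> complex" where
  "window_sum r u i = (\<Sum>k\<in>{i<..<i + r}. u k)"

lemma sum_shift_window:
  assumes "rotating r z u"
  shows "(\<Sum>k\<in>{a + r..<b + r}. u k) = z * (\<Sum>k\<in>{a..<b}. u k)"
  by (simp add: sum.shift_bounds_nat_ivl rotating_shift[OF assms] sum_distrib_left)

lemma window_sum_shift:
  assumes "rotating r z u"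
  shows "window_sum r u (i + r) = z * window_sum r u i"
  using sum_shift_window[OF assms, of "Suc i" "i + r"]
  by (simp add: window_sum_def atLeastSucLessThan_greaterThanLessThan)

text \<open>The two windows share the block \<open>m\<close>. Expanding the cross product bilinearly
  around it leaves only nonnegative terms, \<open>cross m m\<close> being 0.\<close>

lemma window_sum_cross:
  assumes rot: "rotating r z u" and z: "Im z > 0" and ij: "i < j" "j < i + r"
  shows "0 \<le> cross (window_sum r u i) (window_sum r u j)"
proof -
  define p where "p = (\<Sum>k\<in>{i<..<j}. u k)"
  define m where "m = (\<Sum>k\<in>{j<..<i + r}. u k)"
  have "{i<..<i + r} = {i<..<j} \<union> insert j {j<..<i + r}"
    using ij by auto
  then have gi: "window_sum r u i = p + (u j + m)"
    unfolding window_sum_def p_def m_def by (subst \<open>{i<..<i + r} = _\<close>, subst sum.union_disjoint) auto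
  \<comment> \<open>From \<open>i + r\<close> on, the window of \<open>j\<close> repeats the indices
    \<open>i..<j\<close> one period later. The index \<open>i\<close> is not in its own window, so
    \<open>z * u i\<close> appears besides \<open>z * p\<close>.\<close>
  have "(\<Sum>k\<in>{i + r..<j + r}. u k) = z * u i + z * p"
    using ij by (simp add: sum_shift_window[OF rot] sum.atLeast_Suc_lessThan p_def
        atLeastSucLessThan_greaterThanLessThan distrib_left)
  moreover have "{j<..<j + r} = {j<..<i + r} \<union> {i + r..<j + r}" "{j<..<i + r} \<inter> {i + r..<j + r} = {}"
    using ij by auto
  ultimately have gj: "window_sum r u j = m + (z * u i + z * p)"
    unfolding window_sum_def m_def by (simp add: sum.union_disjoint)
  have "0 \<le> cross p m" "0 \<le> cross m (z * p)" "0 \<le> cross p (z * u i)" "0 \<le> cross m (z * u i)"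
    "0 \<le> cross (u j) m" "0 \<le> cross (u j) (z * p)" "0 \<le> cross (u j) (z * u i)"
    unfolding p_def m_def sum_distrib_left cross_sum_left cross_sum_right
    using ij by (auto intro!: sum_nonneg rotating_cross[OF rot] rotating_cross_shift[OF rot])
  \<comment> \<open>This pair cannot be handled term by term, since its indices may lie more than
    one period apart. As a whole, \<open>p\<close> is turned by the angle of
    \<open>z\<close>.\<close>
  moreover have "0 \<le> cross p (z * p)"
    using z by (simp add: cross_mult_self)
  ultimately show ?thesis
    unfolding gi gj cross_add_left cross_add_right by simp
qed

lemma rotating_window_sum:
  assumes rot: "rotating r z u" and z: "Im z > 0"
  shows "rotating r z (window_sum r u)"
  unfolding rotating_def
proof (intro conjI allI impI)
  fix i j assume ij: "i \<le> j" "j \<le> i + r"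
  then consider "j = i" | "j = i + r" | "i < j" "j < i + r" by linarith
  then show "0 \<le> cross (window_sum r u i) (window_sum r u j)"
  proof cases
    case 2
    then show ?thesis using z by (simp add: window_sum_shift[OF rot] cross_mult_self)
  qed (use window_sum_cross[OF rot z] in auto)
qed (rule window_sum_shift[OF rot])

lemma rotating_sum_eq_0:
  assumes rot: "rotating r z u" and z: "Im z > 0"
  shows "b \<le> a + r \<Longrightarrow> (\<Sum>k\<in>{a..<b}. u k) = 0 \<Longrightarrow> k \<in> {a..<b} \<Longrightarrow> u k = 0"
proof (induction "b - a" arbitrary: a)
  case (Suc d)
  then have ab: "a < b" by simp
  have "0 \<le> (\<Sum>k\<in>{Suc a..<b}. cross (u k) (z * u a))"
    using Suc.prems by (auto intro!: sum_nonneg rotating_cross_shift[OF rot])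
  moreover have "(\<Sum>k\<in>{a..<b}. cross (u k) (z * u a)) = 0"
    unfolding cross_sum_left[symmetric] Suc.prems(2) by (simp add: cross_def)
  ultimately have "cross (u a) (z * u a) \<le> 0"
    using ab by (simp add: sum.atLeast_Suc_lessThan)
  then have ua: "u a = 0"
    using z by (simp add: cross_mult_self mult_le_0_iff)
  with Suc.prems ab have "(\<Sum>k\<in>{Suc a..<b}. u k) = 0"
    by (simp add: sum.atLeast_Suc_lessThan)
  moreover have "d = b - Suc a" "b \<le> Suc a + r"
    using Suc.hyps(2) Suc.prems(1) by auto
  ultimately show ?case
    using Suc.hyps(1)[of "Suc a"] Suc.prems(3) ua by (cases "k = a") auto
qed auto

lemma window_sum_eq_0_iff:
  assumes "rotating r z u" "Im z > 0"
  shows "window_sum r u i = 0 \<longleftrightarrow> (\<forall>k\<in>{i<..<i + r}. u k = 0)"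
  using rotating_sum_eq_0[OF assms, of "i + r" "Suc i"]
  by (auto simp: window_sum_def atLeastSucLessThan_greaterThanLessThan)

text \<open>The indices below \<open>r\<close> are the last letters. The start encodes the single
  word \<open>[0]\<close>, with value 1 at letter 0 and 0 at the others, continued by a factor
  \<open>z\<close> per period.\<close>

primrec values_at :: "nat \<Rightarrow> complex \<Rightarrow> nat \<Rightarrow> nat \<Rightarrow> complex" where
  "values_at r z 0 = (\<lambda>k. if r dvd k then z ^ (k div r) else 0)"
| "values_at r z (Suc n) = window_sum r (values_at r z n)"

lemma rotating_values_at:
  assumes "r > 0" "Im z > 0"
  shows "rotating r z (values_at r z n)"
proof (induction n)
  case 0
  \<comment> \<open>Only multiples of \<open>r\<close> carry nonzero values, and two of them within
    one period are equal or exactly \<open>r\<close> apart.\<close>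
  have "0 \<le> cross (z ^ (a div r)) (z ^ (b div r))"
    if "a \<le> b" "b \<le> a + r" "r dvd a" "r dvd b" for a b
  proof -
    from that have "r dvd b - a" by simp
    then obtain c where "b - a = r * c" by (rule dvdE)
    with that have b: "b = a + r * c" by simp
    with that assms have "c = 0 \<or> c = 1"
      by (cases c) auto
    then show ?thesis
      using assms by (auto simp: b cross_mult_self)
  qed
  then show ?case
    using assms by (auto simp: rotating_def) (simp_all add: cross_def)
next
  case (Suc n)
  then show ?case
    using assms by (simp add: rotating_window_sum)
qed

text \<open>A window sum vanishes exactly when its terms do, a condition that passes from
  \<open>z\<close> to \<open>w\<close> by induction. Initially the zeros are the non-multiples of
  \<open>r\<close>, as \<open>z\<close> and \<open>w\<close> are nonzero.\<close>

lemma values_at_eq_0_iff: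
  assumes "r > 0" "Im z > 0" "Im w > 0"
  shows "values_at r z n k = 0 \<longleftrightarrow> values_at r w n k = 0"
proof (induction n arbitrary: k)
  case 0
  from assms have "z \<noteq> 0" "w \<noteq> 0" by auto
  then show ?case by simp
next
  case (Suc n)
  then show ?case
    using assms by (simp add: window_sum_eq_0_iff[OF rotating_values_at])
qed

section \<open>Words with a prescribed last letter, counted by ascents\<close>

definition words_to :: "nat \<Rightarrow> nat \<Rightarrow> nat \<Rightarrow> nat list set" where
  "words_to r n i = {w \<in> SW' n r. w ! n = i}"

lemma finite_words_to: "finite (words_to r n i)"
  by (rule finite_subset[OF _ finite_lists_length_eq[of "{0..<r}" "n + 1"]])
    (auto simp: words_to_def SW'_def)

lemma words_to_0: "r > 0 \<Longrightarrow> words_to r 0 i = (if i = 0 then {[0]} else {})"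
  by (auto simp: words_to_def SW'_def length_Suc_conv)

lemma words_to_Suc:
  assumes "i < r"
  shows "words_to r (Suc n) i = (\<Union>k\<in>{..<r} - {i}. (\<lambda>w. w @ [i]) ` words_to r n k)"
proof (intro equalityI subsetI)
  fix w assume w: "w \<in> words_to r (Suc n) i"
  then have len: "length w = n + 2" and set: "set w \<subseteq> {0..<r}"
    and adj: "\<And>j. j \<le> n \<Longrightarrow> w ! j \<noteq> w ! Suc j" and w0: "w ! 0 = 0" and wn: "w ! Suc n = i"
    by (auto simp: words_to_def SW'_def)
  define v where "v = butlast w"
  have "w \<noteq> []" using len by auto
  then have wv: "w = v @ [i]"
    using wn len by (metis v_def append_butlast_last_id last_conv_nth diff_Suc_1 add_2_eq_Suc')
  have lv: "length v = n + 1" using len by (simp add: v_def)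
  have nth: "w ! j = v ! j" if "j \<le> n" for j
    using that lv by (simp add: wv nth_append)
  have "w ! n \<in> set w" using len by simp
  then have "v ! n \<in> {..<r} - {i}"
    using set adj[of n] wn nth[of n] by auto
  moreover have "v \<in> words_to r n (v ! n)"
    using lv set adj w0 nth by (auto simp: words_to_def SW'_def wv nth_append) (metis less_imp_le_nat)
  ultimately show "w \<in> (\<Union>k\<in>{..<r} - {i}. (\<lambda>w. w @ [i]) ` words_to r n k)"
    using wv by blast
next
  fix w assume "w \<in> (\<Union>k\<in>{..<r} - {i}. (\<lambda>w. w @ [i]) ` words_to r n k)"
  then show "w \<in> words_to r (Suc n) i"
    using assms by (auto simp: words_to_def SW'_def nth_append less_Suc_eq split: if_splits)
qed

lemma asc_snoc:
  assumes "length w = Suc n"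
  shows "asc (w @ [i]) = asc w + (if w ! n < i then 1 else 0)"
proof -
  have "{j. j + 1 < length (w @ [i]) \<and> (w @ [i]) ! j < (w @ [i]) ! (j + 1)} =
      {j. j + 1 < length w \<and> w ! j < w ! (j + 1)} \<union> (if w ! n < i then {n} else {})"
    using assms by (auto simp: nth_append less_Suc_eq split: if_splits)
  moreover have "finite {j. j + 1 < length w \<and> w ! j < w ! (j + 1)}"
    by (rule finite_subset[of _ "{..<length w}"]) auto
  ultimately show ?thesis
    using assms by (auto simp: asc_def)
qed

text \<open>Classify by the letter \<open>k\<close> before the last: \<open>k > i\<close> creates a
  descent, \<open>k < i\<close> an ascent and thus a factor \<open>z\<close>.\<close>

lemma sum_words_to_Suc:
  fixes z :: complex
  assumes "i < r"
  shows "(\<Sum>w\<in>words_to r (Suc n) i. z ^ asc w) =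
    (\<Sum>k\<in>{i<..<r}. \<Sum>w\<in>words_to r n k. z ^ asc w) + z * (\<Sum>k<i. \<Sum>w\<in>words_to r n k. z ^ asc w)"
proof -
  have "(\<Sum>w\<in>words_to r (Suc n) i. z ^ asc w) =
      (\<Sum>k\<in>{..<r} - {i}. \<Sum>w\<in>(\<lambda>w. w @ [i]) ` words_to r n k. z ^ asc w)"
    unfolding words_to_Suc[OF assms]
    by (rule sum.UNION_disjoint) (auto simp: finite_words_to, auto simp: words_to_def)
  also have "\<dots> = (\<Sum>k\<in>{..<r} - {i}. \<Sum>w\<in>words_to r n k. z ^ asc w * (if k < i then z else 1))"
    by (rule sum.cong[OF refl], subst sum.reindex)
      (auto simp: inj_on_def words_to_def SW'_def asc_snoc[of _ n] intro!: sum.cong)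
  also have "\<dots> = (\<Sum>k\<in>{i<..<r} \<union> {..<i}. \<Sum>w\<in>words_to r n k. z ^ asc w * (if k < i then z else 1))"
    using assms by (intro sum.cong) auto
  also have "\<dots> = (\<Sum>k\<in>{i<..<r}. \<Sum>w\<in>words_to r n k. z ^ asc w * (if k < i then z else 1)) +
      (\<Sum>k<i. \<Sum>w\<in>words_to r n k. z ^ asc w * (if k < i then z else 1))"
    by (rule sum.union_disjoint) auto
  finally show ?thesis
    by (simp add: sum_distrib_left mult.commute)
qed

lemma values_at_eq_sum:
  assumes "r > 0" "Im z > 0" "i < r"
  shows "values_at r z n i = (\<Sum>w\<in>words_to r n i. z ^ asc w)"
  using assms(3)
proof (induction n arbitrary: i)
  case 0
  then show ?case
    using assms by (auto simp: words_to_0 asc_def dest: dvd_imp_le)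
next
  case (Suc n)
  let ?u = "values_at r z n"
  \<comment> \<open>The window is cut at \<open>r\<close>: indices from \<open>r\<close> on stand
    for the letters below \<open>i\<close>, and the factor \<open>z\<close> of their period shift is
    the weight of the new ascent.\<close>
  have "{i<..<i + r} = {i<..<r} \<union> {0 + r..<i + r}" "{i<..<r} \<inter> {0 + r..<i + r} = {}"
    using Suc.prems by auto
  then have "values_at r z (Suc n) i = (\<Sum>k\<in>{i<..<r}. ?u k) + (\<Sum>k\<in>{0 + r..<i + r}. ?u k)"
    by (simp add: window_sum_def sum.union_disjoint)
  also have "\<dots> = (\<Sum>k\<in>{i<..<r}. ?u k) + z * (\<Sum>k<i. ?u k)"
    unfolding sum_shift_window[OF rotating_values_at[OF assms(1,2)]] by (simp add: atLeast0LessThan)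
  finally show ?case
    using Suc by (simp add: sum_words_to_Suc)
qed

section \<open>From pointwise values to the zeros of the polynomial\<close>

lemma poly_of_real_sum_monom:
  fixes z :: complex
  assumes "finite W"
  shows "poly (map_poly complex_of_real (\<Sum>w\<in>W. monom 1 (f w))) z = (\<Sum>w\<in>W. z ^ f w)"
proof -
  have "map_poly complex_of_real (\<Sum>w\<in>W. monom 1 (f w)) = (\<Sum>w\<in>W. monom 1 (f w))"
    by (rule poly_eqI) (auto simp: coeff_map_poly coeff_sum intro!: sum.cong)
  then show ?thesis
    by (simp add: poly_sum poly_monom)
qed

lemma poly_E_eq_values_at:
  assumes "r > 0" "Im z > 0" "i < r"
  shows "poly (map_poly complex_of_real (E r n i)) z = values_at r z n i"
  by (simp add: values_at_eq_sum[OF assms] E_def poly_of_real_sum_monom finite_words_to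
      flip: words_to_def)

lemma poly_map_of_real_cnj:
  "poly (map_poly complex_of_real p) (cnj z) = cnj (poly (map_poly complex_of_real p) z)"
  by (simp add: poly_altdef coeff_map_poly)

lemma poly_eq_0_if_upper_half_plane:
  fixes p :: "complex poly"
  assumes "\<And>z. Im z > 0 \<Longrightarrow> poly p z = 0"
  shows "p = 0"
proof (rule ccontr)
  assume "p \<noteq> 0"
  then have "finite {z. poly p z = 0}"
    by (rule poly_roots_finite)
  \<comment> \<open>Infinitely many points of the upper half plane, all with imaginary part 1,
    contradict the finiteness of the zero set.\<close>
  moreover have "range (\<lambda>k. Complex (real k) 1) \<subseteq> {z. poly p z = 0}"
    using assms by auto
  ultimately have "finite (range (\<lambda>k. Complex (real k) 1))"
    by (rule rev_finite_subset)
  then show False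
    by (simp add: finite_image_iff inj_def)
qed

theorem theorem2p4:
  fixes i r n :: nat
  assumes "n \<ge> 1" and "r \<ge> 2" and "i \<le> r - 1"
  shows "only_real_zeros (E r n i)"
  unfolding only_real_zeros_def disj_imp
proof (intro allI impI)
  fix z :: complex
  assume nz: "E r n i \<noteq> 0" and z: "poly (map_poly complex_of_real (E r n i)) z = 0"
  have r: "r > 0" "i < r" using assms by auto
  have no_zero: False if "Im w > 0" "poly (map_poly complex_of_real (E r n i)) w = 0" for w
  proof -
    have "values_at r w n i = 0"
      using that r by (simp add: poly_E_eq_values_at)
    then have "map_poly complex_of_real (E r n i) = 0"
      using values_at_eq_0_iff[OF r(1) that(1)] r
      by (intro poly_eq_0_if_upper_half_plane) (metis poly_E_eq_values_at)
    with nz show False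
      by (simp add: map_poly_eq_0_iff)
  qed
  \<comment> \<open>The coefficients are real, so conjugation carries a zero in the lower half plane
    to one in the upper, already excluded.\<close>
  have "Im z = 0"
    using no_zero[of z] no_zero[of "cnj z"] z by (force simp: poly_map_of_real_cnj)
  then show "z \<in> \<real>"
    by (simp add: complex_is_Real_iff)
qed

end
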